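(* Let $n\geq 3$ be an odd integer. If a planar integral lattice $L$ contains an equilateral $n$-gon (not necessarily convex), then $n\geq p$ for every prime factor $p$ of $\nu(L)$.
   Context: A planar lattice is a set $L[\mathbf{a},\mathbf{b}]=\{m\mathbf{a}+n\mathbf{b}\mid m,n\in\mathbb{Z}\}\subset\mathbb{R}^2$ for linearly independent vectors $\mathbf{a},\mathbf{b}\in\mathbb{R}^2$. It is integral if $\mathbf{x}\cdot\mathbf{y}\in\mathbb{Z}$ for all $\mathbf{x},\mathbf{y}\in L$. $D(L)=|\det(\mathbf{a},\mathbf{b})|$ is the area of a fundamental parallelogram (independent of the choice of generators); for integral $L$, $D(L)^2$ is a positive integer, and $\nu(L)$ denotes its square-free part, i.e. the square-free positive integer with $D(L)^2=k^2\nu(L)$ for some integer $k$. An equilateral $n$-gon is a polygon with $n$ vertices whose sides all have equal length; a set $S$ contains a polygon if every vertex of the polygon lies in $S$. *)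

theory Defs
  imports
    "HOL-Analysis.Analysis"
    "HOL-Computational_Algebra.Squarefree"
begin

definition lattice_gen :: "real^2 \<Rightarrow> real^2 \<Rightarrow> (real^2) set" where
  "lattice_gen a b = {of_int m *\<^sub>R a + of_int n *\<^sub>R b | m n :: int. True}"

(* The clause a \<noteq> b is needed because independent {a, b} concerns the set {a, b},
   which is a singleton for a = b. *)
definition lattice_basis :: "real^2 \<Rightarrow> real^2 \<Rightarrow> (real^2) set \<Rightarrow> bool" where
  "lattice_basis a b L \<longleftrightarrow> a \<noteq> b \<and> independent {a, b} \<and> L = lattice_gen a b"

definition planar_lattice :: "(real^2) set \<Rightarrow> bool" where
  "planar_lattice L \<longleftrightarrow> (\<exists>a b. lattice_basis a b L)"

definition integral_lattice :: "(real^2) set \<Rightarrow> bool" where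
  "integral_lattice L \<longleftrightarrow> planar_lattice L \<and> (\<forall>x\<in>L. \<forall>y\<in>L. x \<bullet> y \<in> \<int>)"

(* Area of a fundamental parallelogram; the choice of generators is immaterial by
   lattice_area_eq below. *)
definition lattice_area :: "(real^2) set \<Rightarrow> real" where
  "lattice_area L = (THE d. \<exists>a b. lattice_basis a b L \<and> d = \<bar>det (vector [a, b] :: real^2^2)\<bar>)"

(* Meaningful for integral lattices, where the squared area is a positive integer and the
   floor changes nothing; see lattice_nu_decompose and lattice_nu_unique below. *)
definition lattice_nu :: "(real^2) set \<Rightarrow> nat" where
  "lattice_nu L = squarefree_part (nat \<lfloor>(lattice_area L)\<^sup>2\<rfloor>)"

(* A polygon is given by the list of its vertices in cyclic order. The vertices are distinct,
   but neither convexity nor the absence of self-intersections is required. *)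
definition polygon :: "nat \<Rightarrow> (real^2) list \<Rightarrow> bool" where
  "polygon n vs \<longleftrightarrow> n \<ge> 3 \<and> length vs = n \<and> distinct vs"

definition equilateral_polygon :: "nat \<Rightarrow> (real^2) list \<Rightarrow> bool" where
  "equilateral_polygon n vs \<longleftrightarrow>
     polygon n vs \<and> (\<exists>s. \<forall>i<n. dist (vs ! i) (vs ! (Suc i mod n)) = s)"

definition contains_polygon :: "(real^2) set \<Rightarrow> (real^2) list \<Rightarrow> bool" where
  "contains_polygon S vs \<longleftrightarrow> set vs \<subseteq> S"


lemma det_lattice_pair:
  fixes a b :: "real^2"
  shows "det (vector [a, b] :: real^2^2) = a$1 * b$2 - a$2 * b$1"
  by (simp add: det_2)

lemma lattice_basis_det_nonzero:
  assumes "lattice_basis a b L"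
  shows "det (vector [a, b] :: real^2^2) \<noteq> 0"
proof
  assume "det (vector [a, b] :: real^2^2) = 0"
  then have d: "a$1 * b$2 = a$2 * b$1"
    by (simp add: det_lattice_pair)
  have ind: "independent {a, b}" "a \<noteq> b"
    using assms by (auto simp: lattice_basis_def)
  have nz: "b \<noteq> 0"
    using ind(1) dependent_zero[of "{a, b}"] by blast
  have "a \<notin> span {b}"
    using ind by (simp add: independent_insert)
  moreover have "a \<in> span {b}"
  proof (cases "b$1 = 0")
    case True
    then have "b$2 \<noteq> 0"
      using nz by (auto simp: vec_eq_iff forall_2)
    with True d have "a = (a$2 / b$2) *\<^sub>R b"
      by (auto simp: vec_eq_iff forall_2)
    then show ?thesis by (metis span_base span_scale singletonI)
  next
    case False
    with d have "a = (a$1 / b$1) *\<^sub>R b"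
      by (auto simp: vec_eq_iff forall_2 field_simps)
    then show ?thesis by (metis span_base span_scale singletonI)
  qed
  ultimately show False by simp
qed

lemma lattice_det_dvd:
  assumes "c \<in> lattice_gen a b" "d \<in> lattice_gen a b"
  shows "\<exists>k::int. det (vector [c, d] :: real^2^2) = of_int k * det (vector [a, b] :: real^2^2)"
proof -
  obtain m n where c: "c = of_int m *\<^sub>R a + of_int n *\<^sub>R b"
    using assms(1) by (auto simp: lattice_gen_def)
  obtain p q where d: "d = of_int p *\<^sub>R a + of_int q *\<^sub>R b"
    using assms(2) by (auto simp: lattice_gen_def)
  have "det (vector [c, d] :: real^2^2) = of_int (m * q - n * p) * det (vector [a, b] :: real^2^2)"
    unfolding det_lattice_pair c d by (simp add: algebra_simps)
  then show ?thesis ..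
qed

lemma lattice_gen_generators: "a \<in> lattice_gen a b" "b \<in> lattice_gen a b"
proof -
  have "a = of_int 1 *\<^sub>R a + of_int 0 *\<^sub>R b" "b = of_int 0 *\<^sub>R a + of_int 1 *\<^sub>R b"
    by simp_all
  then show "a \<in> lattice_gen a b" "b \<in> lattice_gen a b"
    unfolding lattice_gen_def by blast+
qed

lemma lattice_det_le:
  assumes "lattice_basis a b L" "lattice_basis c d L"
  shows "\<bar>det (vector [a, b] :: real^2^2)\<bar> \<le> \<bar>det (vector [c, d] :: real^2^2)\<bar>"
proof -
  have "c \<in> lattice_gen a b" "d \<in> lattice_gen a b"
    using assms lattice_gen_generators[where a=c and b=d] by (auto simp: lattice_basis_def)
  then obtain k :: int
    where k: "det (vector [c, d] :: real^2^2) = of_int k * det (vector [a, b] :: real^2^2)"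
    using lattice_det_dvd by blast
  then have "k \<noteq> 0"
    using lattice_basis_det_nonzero[OF assms(2)] by auto
  then have "1 \<le> \<bar>real_of_int k\<bar>"
    by linarith
  then show ?thesis
    unfolding k abs_mult using mult_right_mono[of 1 "\<bar>real_of_int k\<bar>"] by fastforce
qed

lemma lattice_area_eq:
  assumes "lattice_basis a b L"
  shows "lattice_area L = \<bar>det (vector [a, b] :: real^2^2)\<bar>"
  unfolding lattice_area_def
proof (rule the_equality)
  show "\<exists>a' b'. lattice_basis a' b' L \<and> \<bar>det (vector [a, b] :: real^2^2)\<bar> = \<bar>det (vector [a', b'] :: real^2^2)\<bar>"
    using assms by blast
next
  fix d assume "\<exists>a b. lattice_basis a b L \<and> d = \<bar>det (vector [a, b] :: real^2^2)\<bar>"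
  then show "d = \<bar>det (vector [a, b] :: real^2^2)\<bar>"
    using assms lattice_det_le by (metis order_antisym)
qed

lemma lattice_area_sq_pos_int:
  assumes "integral_lattice L"
  obtains m :: nat where "m > 0" "(lattice_area L)\<^sup>2 = of_nat m"
proof -
  obtain a b where ab: "lattice_basis a b L"
    using assms by (auto simp: integral_lattice_def planar_lattice_def)
  then have mem: "a \<in> L" "b \<in> L"
    using lattice_gen_generators by (auto simp: lattice_basis_def)
  have "(lattice_area L)\<^sup>2 = (a \<bullet> a) * (b \<bullet> b) - (a \<bullet> b) * (a \<bullet> b)"
    unfolding lattice_area_eq[OF ab] det_lattice_pair
    by (simp add: inner_vec_def sum_2 power2_eq_square algebra_simps)
  also have "\<dots> \<in> \<int>"
    using assms mem by (auto simp: integral_lattice_def)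
  finally obtain k :: int where k: "(lattice_area L)\<^sup>2 = of_int k"
    by (elim Ints_cases)
  have "(lattice_area L)\<^sup>2 > 0"
    using lattice_basis_det_nonzero[OF ab] by (simp add: lattice_area_eq[OF ab])
  with k have "k > 0" by simp
  then show thesis
    using that[of "nat k"] k by simp
qed

lemma lattice_nu_decompose:
  assumes "integral_lattice L"
  shows "squarefree (lattice_nu L)" "\<exists>k::int. (lattice_area L)\<^sup>2 = (of_int k)\<^sup>2 * of_nat (lattice_nu L)"
proof -
  obtain m where m: "m > 0" "(lattice_area L)\<^sup>2 = of_nat m"
    using lattice_area_sq_pos_int[OF assms] .
  then have nu: "lattice_nu L = squarefree_part m"
    by (simp add: lattice_nu_def)
  show "squarefree (lattice_nu L)"
    by (simp add: nu)
  have "real m = (of_int (int (square_part m)))\<^sup>2 * of_nat (lattice_nu L)"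
    unfolding nu by (subst squarefree_decompose[of m]) (simp add: mult.commute)
  then show "\<exists>k::int. (lattice_area L)\<^sup>2 = (of_int k)\<^sup>2 * of_nat (lattice_nu L)"
    using m(2) by metis
qed

lemma lattice_nu_unique:
  fixes v :: nat and k :: int
  assumes "integral_lattice L" "squarefree v" "(lattice_area L)\<^sup>2 = (of_int k)\<^sup>2 * of_nat v"
  shows "lattice_nu L = v"
proof -
  obtain m where m: "m > 0" "(lattice_area L)\<^sup>2 = of_nat m"
    using lattice_area_sq_pos_int[OF assms(1)] .
  have "real m = real ((nat \<bar>k\<bar>)\<^sup>2 * v)"
    using m(2) assms(3) by (simp add: power2_abs)
  then have eq: "m = (nat \<bar>k\<bar>)\<^sup>2 * v"
    using of_nat_eq_iff by blast
  have nz: "nat \<bar>k\<bar> \<noteq> 0" "v \<noteq> 0"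
    using m(1) eq by auto
  have "squarefree_part m = v"
  proof (rule multiplicity_eq_nat)
    show "squarefree_part m > 0" "v > 0"
      using nz squarefree_part_nonzero[of m] unfolding neq0_conv by simp_all
    fix p :: nat assume p: "prime p"
    have "multiplicity p v \<le> 1"
      using assms(2) p nz(2) squarefree_factorial_semiring'' by auto
    moreover have "multiplicity p m = 2 * multiplicity p (nat \<bar>k\<bar>) + multiplicity p v"
      unfolding eq using nz p
      by (simp add: prime_elem_multiplicity_mult_distrib prime_elem_multiplicity_power_distrib)
    ultimately show "multiplicity p (squarefree_part m) = multiplicity p v"
      using p by (simp add: prime_multiplicity_squarefree_part)
  qed
  then show ?thesis
    using m(2) by (simp add: lattice_nu_def)
qed

end

theory Submission
  imports Defs
begin

text \<open>Fix one edge \<open>u\<close> of the polygon and put \<open>N = u \<bullet> u\<close>. For every edge \<open>v\<close>, Lagrange's identity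
  gives \<open>(u \<bullet> v)\<^sup>2 + det(u, v)\<^sup>2 = N\<^sup>2\<close>, where \<open>det(u, v)\<close> is an integer multiple of \<open>D(L)\<close>. Since \<open>p\<close>
  divides \<open>D(L)\<^sup>2\<close> to an odd power, a descent on the power \<open>p\<^sup>t\<close> of \<open>p\<close> in \<open>N\<close> shows that \<open>p\<^sup>t\<close> divides
  \<open>u \<bullet> v\<close> and \<open>(u \<bullet> v) / p\<^sup>t \<equiv> \<plusminus> N / p\<^sup>t\<close> modulo \<open>p\<close>. The edges sum to zero, so a sum of \<open>n\<close> signs is
  divisible by \<open>p\<close>; it is nonzero because \<open>n\<close> is odd, hence \<open>p \<le> n\<close>.\<close>

text \<open>For \<open>t > 0\<close>, \<open>p\<close> divides the square of \<open>c\<close> and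
  hence \<open>c\<close>; cancelling one \<open>p\<close> then shows that \<open>p\<close> divides
  \<open>x\<close>, because it does not divide \<open>w\<close>. The whole equation can be divided
  by the square of \<open>p\<close>, which lowers \<open>t\<close> by one. At \<open>t = 0\<close>
  it says that \<open>c\<close> and \<open>M\<close> have equal squares modulo
  \<open>p\<close>.\<close>

lemma square_plus_prime_square_descent:
  fixes p w c x M :: int
  assumes "prime p" "\<not> p dvd w"
    and "c\<^sup>2 + x\<^sup>2 * (p * w) = (p ^ t * M)\<^sup>2"
  shows "\<exists>c'. c = p ^ t * c' \<and> p dvd (c' - M) * (c' + M)"
  using assms(3)
proof (induction t arbitrary: c x)
  case 0
  then have "(c - M) * (c + M) = p * (- (x\<^sup>2 * w))"
    by (simp add: algebra_simps power2_eq_square)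
  then show ?case by simp
next
  case (Suc t)
  have pp: "p \<noteq> 0" using assms(1) by auto
  have "c\<^sup>2 = p * (p * (p ^ t * M)\<^sup>2 - x\<^sup>2 * w)"
    using Suc.prems by (simp add: algebra_simps power2_eq_square)
  then have "p dvd c"
    using assms(1) by (metis dvd_triv_left prime_dvd_power)
  then obtain d where d: "c = p * d" ..
  have "p * (x\<^sup>2 * w) = p * (p * ((p ^ t * M)\<^sup>2 - d\<^sup>2))"
    using Suc.prems unfolding d by (simp add: algebra_simps power2_eq_square)
  then have "x\<^sup>2 * w = p * ((p ^ t * M)\<^sup>2 - d\<^sup>2)"
    using pp by simp
  then have "p dvd x\<^sup>2 * w" by simp
  then have "p dvd x"
    using assms(1,2) by (meson prime_dvd_multD prime_dvd_power)
  then obtain y where y: "x = p * y" ..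
  have "p\<^sup>2 * (d\<^sup>2 + y\<^sup>2 * (p * w)) = p\<^sup>2 * (p ^ t * M)\<^sup>2"
    using Suc.prems unfolding d y by (simp add: algebra_simps power2_eq_square)
  then have "d\<^sup>2 + y\<^sup>2 * (p * w) = (p ^ t * M)\<^sup>2"
    using pp by simp
  from Suc.IH[OF this] show ?case
    unfolding d by auto
qed

text \<open>An odd number of signs has an odd, hence nonzero, sum. A nonzero multiple of
  \<open>p\<close> is at least \<open>p\<close> in absolute value, while the triangle inequality
  bounds the sum by the number of signs.\<close>

lemma prime_le_card_if_sum_signs:
  fixes p :: int and \<epsilon> :: "'a \<Rightarrow> int"
  assumes "finite I" "odd (card I)" "p dvd sum \<epsilon> I"
    and sign: "\<And>i. i \<in> I \<Longrightarrow> \<epsilon> i = 1 \<or> \<epsilon> i = -1"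
  shows "p \<le> int (card I)"
proof -
  have "even (\<Sum>i\<in>I. \<epsilon> i - 1)"
    using sign by (intro dvd_sum) fastforce
  then have "odd (sum \<epsilon> I)"
    using assms(2) by (simp add: sum_subtractf)
  then have nz: "sum \<epsilon> I \<noteq> 0" by auto
  have "\<bar>sum \<epsilon> I\<bar> \<le> (\<Sum>i\<in>I. \<bar>\<epsilon> i\<bar>)" by (rule sum_abs)
  also have "\<dots> = int (card I)"
    using sign by (subst sum.cong[where h = "\<lambda>_. 1"]) (auto, fastforce)
  finally have "\<bar>sum \<epsilon> I\<bar> \<le> int (card I)" .
  moreover have "p \<le> \<bar>sum \<epsilon> I\<bar>"
    using dvd_imp_le_int[OF nz assms(3)] by linarith
  ultimately show ?thesis by linarith
qed

text \<open>The arithmetic core, free of geometry: \<open>c i\<close> will be the inner product of a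
  fixed edge with the \<open>i\<close>-th edge, and \<open>N\<close> the squared side
  length.\<close>

lemma prime_le_card_if_sum_zero:
  fixes p w N :: int and c x :: "'a \<Rightarrow> int"
  assumes p: "prime p" "\<not> p dvd w" and N: "N \<noteq> 0"
    and I: "finite I" "odd (card I)"
    and eq: "\<And>i. i \<in> I \<Longrightarrow> (c i)\<^sup>2 + (x i)\<^sup>2 * (p * w) = N\<^sup>2"
    and sum0: "sum c I = 0"
  shows "p \<le> int (card I)"
proof -
  have "\<not> is_unit p" using p(1) by auto
  \<comment> \<open>Splitting off the full power of \<open>p\<close> leaves a cofactor
    \<open>M\<close> that can be cancelled modulo \<open>p\<close> at the end.\<close>
  then obtain M where M: "N = p ^ multiplicity p N * M" "\<not> p dvd M"
    using N multiplicity_decompose'[of N p] by metis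
  define t where "t = multiplicity p N"
  have Mt: "N = p ^ t * M" using M(1) by (simp add: t_def)
  have "\<forall>i\<in>I. \<exists>c'. c i = p ^ t * c' \<and> p dvd (c' - M) * (c' + M)"
    using square_plus_prime_square_descent[OF p] eq Mt by metis
  then obtain c' where c': "\<And>i. i \<in> I \<Longrightarrow> c i = p ^ t * c' i"
      "\<And>i. i \<in> I \<Longrightarrow> p dvd (c' i - M) * (c' i + M)"
    by metis
  \<comment> \<open>By primality \<open>c' i\<close> is congruent to \<open>M\<close> or
    \<open>-M\<close> modulo \<open>p\<close>. For \<open>p = 2\<close> both hold, and the sign 1 is
    chosen.\<close>
  define \<epsilon> where "\<epsilon> i = (if p dvd c' i - M then 1 else -1 :: int)" for i
  have dvd: "p dvd c' i - \<epsilon> i * M" if "i \<in> I" for i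
    using c'(2)[OF that] p(1) by (auto simp: \<epsilon>_def prime_dvd_mult_iff)
  have "p ^ t * sum c' I = 0"
    using sum0 c'(1) by (simp add: sum_distrib_left)
  then have "sum c' I = 0" using p(1) by auto
  moreover have "p dvd (\<Sum>i\<in>I. c' i - \<epsilon> i * M)"
    using dvd by (rule dvd_sum)
  ultimately have "p dvd sum \<epsilon> I * M"
    by (simp add: sum_subtractf sum_distrib_right)
  then have "p dvd sum \<epsilon> I"
    using p(1) M(2) by (simp add: prime_dvd_mult_iff)
  then show ?thesis
    by (rule prime_le_card_if_sum_signs[OF I]) (auto simp: \<epsilon>_def)
qed

lemma lattice_gen_diff:
  assumes "u \<in> lattice_gen a b" "v \<in> lattice_gen a b"
  shows "u - v \<in> lattice_gen a b"
proof -
  obtain m n k l :: int where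
    "u = of_int m *\<^sub>R a + of_int n *\<^sub>R b" "v = of_int k *\<^sub>R a + of_int l *\<^sub>R b"
    using assms by (auto simp: lattice_gen_def)
  then have "u - v = of_int (m - k) *\<^sub>R a + of_int (n - l) *\<^sub>R b"
    by (simp add: algebra_simps)
  then show ?thesis unfolding lattice_gen_def by blast
qed

lemma Lagrange_identity_2:
  fixes u v :: "real^2"
  shows "(u \<bullet> v)\<^sup>2 + (det (vector [u, v] :: real^2^2))\<^sup>2 = (u \<bullet> u) * (v \<bullet> v)"
  unfolding det_lattice_pair
  by (simp add: inner_vec_def sum_2 power2_eq_square algebra_simps)

lemma sum_cyclic_differences:
  fixes f :: "nat \<Rightarrow> 'a::ab_group_add"
  shows "(\<Sum>i<n. f (Suc i mod n) - f i) = 0"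
proof (cases n)
  case (Suc m)
  have "(\<Sum>i<m. f (Suc i mod Suc m) - f i) = (\<Sum>i<m. f (Suc i) - f i)"
    by (rule sum.cong) auto
  then show ?thesis
    by (simp add: Suc sum_lessThan_telescope)
qed simp

theorem theorem3p1:
  fixes n :: nat and L :: "(real^2) set"
  assumes "n \<ge> 3" and "odd n"
    and "integral_lattice L"
    and "\<exists>vs. equilateral_polygon n vs \<and> contains_polygon L vs"
  shows "\<forall>p. prime p \<and> p dvd lattice_nu L \<longrightarrow> n \<ge> p"
proof (intro allI impI, elim conjE)
  fix p assume p: "prime p" "p dvd lattice_nu L"
  obtain w where w: "lattice_nu L = p * w" using p(2) ..
  \<comment> \<open>Square-freeness makes \<open>p\<close> divide \<open>lattice_nu L\<close>
    exactly once, as the descent requires.\<close>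
  have "\<not> p dvd w"
  proof
    assume "p dvd w"
    then have "p\<^sup>2 dvd lattice_nu L" unfolding w power2_eq_square by simp
    then show False
      using lattice_nu_decompose(1)[OF assms(3)] p(1) not_prime_unit squarefreeD by blast
  qed
  then have pw: "prime (int p)" "\<not> int p dvd int w" using p(1) by auto
  obtain k :: int where k: "(lattice_area L)\<^sup>2 = (of_int k)\<^sup>2 * of_nat (lattice_nu L)"
    using lattice_nu_decompose(2)[OF assms(3)] by blast
  obtain a b where ab: "lattice_basis a b L"
    using assms(3) by (auto simp: integral_lattice_def planar_lattice_def)
  then have L: "L = lattice_gen a b" by (simp add: lattice_basis_def)
  obtain vs s where vs: "length vs = n" "distinct vs" "set vs \<subseteq> L"
      and s: "\<And>i. i < n \<Longrightarrow> dist (vs ! i) (vs ! (Suc i mod n)) = s"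
    using assms(4) by (auto simp: equilateral_polygon_def polygon_def contains_polygon_def)
  define e where "e i = vs ! (Suc i mod n) - vs ! i" for i
  have eL: "e i \<in> L" if "i < n" for i
    using that vs(1,3) assms(1) unfolding e_def L
    by (intro lattice_gen_diff) (auto simp: subset_iff)
  have en: "e i \<bullet> e i = s\<^sup>2" if "i < n" for i
    using s[OF that] by (simp add: e_def dist_norm norm_minus_commute flip: power2_norm_eq_inner)
  have int: "e 0 \<bullet> e i \<in> \<int>" if "i < n" for i
    using that eL assms(1,3) by (simp add: integral_lattice_def)
  \<comment> \<open>The vertices with indices 0 and \<open>Suc 0 mod n = 1\<close> are
    distinct.\<close>
  have "e 0 \<noteq> 0"
    using assms(1) vs(1,2) by (simp add: e_def nth_eq_iff_index_eq)
  \<comment> \<open>The floor only changes the type to \<open>int\<close>: integrality of the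
    lattice makes it exact for \<open>i < n\<close>.\<close>
  define c where "c i = \<lfloor>e 0 \<bullet> e i\<rfloor>" for i
  have c: "of_int (c i) = e 0 \<bullet> e i" if "i < n" for i
    using int[OF that] by (simp add: c_def)
  have "\<exists>m::int. det (vector [e 0, e i] :: real^2^2) = of_int m * det (vector [a, b] :: real^2^2)"
    if "i < n" for i
    using that eL assms(1) unfolding L by (intro lattice_det_dvd) auto
  then obtain m :: "nat \<Rightarrow> int" where
    m: "\<And>i. i < n \<Longrightarrow> det (vector [e 0, e i] :: real^2^2) = of_int (m i) * det (vector [a, b] :: real^2^2)"
    by metis
  \<comment> \<open>This is Lagrange's identity for \<open>e 0\<close> and \<open>e i\<close>. All
    edges have the squared length \<open>c 0\<close>, which gives the right-hand side; the factor
    \<open>k\<close> comes from writing the squared area as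
    \<open>k\<^sup>2 * (p * w)\<close>.\<close>
  have eq: "(c i)\<^sup>2 + (m i * k)\<^sup>2 * (int p * int w) = (c 0)\<^sup>2" if "i < n" for i
  proof -
    have "(det (vector [a, b] :: real^2^2))\<^sup>2 = (of_int k)\<^sup>2 * (of_nat p * of_nat w)"
      using k unfolding lattice_area_eq[OF ab] w by simp
    then have "(det (vector [e 0, e i] :: real^2^2))\<^sup>2
        = of_int ((m i * k)\<^sup>2 * (int p * int w))"
      unfolding m[OF that] by (simp add: power_mult_distrib)
    moreover have "0 < n" using assms(1) by simp
    ultimately have "real_of_int ((c i)\<^sup>2 + (m i * k)\<^sup>2 * (int p * int w)) = of_int ((c 0)\<^sup>2)"
      using Lagrange_identity_2[of "e 0" "e i"] en[OF that] en[of 0] c[OF that] c[of 0]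
      by (simp add: power2_eq_square)
    then show ?thesis by (simp only: of_int_eq_iff)
  qed
  \<comment> \<open>The polygon closes up, so its edge vectors sum to zero.\<close>
  have "real_of_int (\<Sum>i<n. c i) = e 0 \<bullet> (\<Sum>i<n. e i)"
    by (simp add: c inner_sum_right)
  also have "(\<Sum>i<n. e i) = 0"
    unfolding e_def by (rule sum_cyclic_differences)
  finally have sum0: "(\<Sum>i<n. c i) = 0"
    by (simp only: inner_zero_right of_int_eq_0_iff)
  have "real_of_int (c 0) \<noteq> 0"
    using c[of 0] \<open>e 0 \<noteq> 0\<close> assms(1) by simp
  then have "c 0 \<noteq> 0" by simp
  then have "int p \<le> int (card {..<n})"
    using assms(2) eq sum0
    by (intro prime_le_card_if_sum_zero[OF pw, where N = "c 0" and c = c and x = "\<lambda>i. m i * k"]) auto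
  then show "n \<ge> p" by simp
qed

end
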